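(* Let $s>-1$ and $X=L^2[(0,+\infty);w]$ with the generalized Laguerre weight $w(t)=t^s\mathrm{e}^{-t}$, inner product $(p,q)_w=\int_0^{+\infty}p(t)\overline{q(t)}w(t)\,\mathrm dt$ and norm $\|p\|_X=\sqrt{(p,p)_w}$. Let $\ell_0^s,\ell_1^s,\dots$ be the orthonormal polynomials with respect to $w$ (with positive leading coefficients). Fix $n\ge1$, let $A_{n,1}$ be the $n\times n$ upper triangular matrix with entries $a_{i,j}=\int_0^{+\infty}(\ell_j^s)'(t)\,\ell_{i-1}^s(t)\,w(t)\,\mathrm dt$, $i,j=1,\dots,n$, and put $C_{n,1}=(A_{n,1}^T)^{-1}A_{n,1}^{-1}$. Then $C_{n,1}$ is the symmetric tridiagonal matrix $$C_{n,1}=\begin{bmatrix}\alpha_0&\sqrt{\beta_1}&&&\\ \sqrt{\beta_1}&\alpha_1&\sqrt{\beta_2}&&\\ &\sqrt{\beta_2}&\alpha_2&\ddots&\\ &&\ddots&\ddots&\sqrt{\beta_{n-1}}\\ &&&\sqrt{\beta_{n-1}}&\alpha_{n-1}\end{bmatrix},$$ where $\alpha_0=1+s$, $\alpha_\nu=2+\frac{s}{\nu+1}$ and $\beta_\nu=1+\frac{s}{\nu}$ for $\nu=1,\dots,n-1$. Moreover, defining the monic polynomials $\pi_\nu$ by $\pi_{-1}(x)=0$, $\pi_0(x)=1$, and $\pi_{\nu+1}(x)=(x-\alpha_\nu)\pi_\nu(x)-\beta_\nu\pi_{\nu-1}(x)$ for $\nu=0,1,\dots,n-1$, the best constant $$M_n(s)=\sup_{p\in\mathcal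 P_n\setminus\{0\}}\frac{\|p'\|_X}{\|p\|_X}$$ (where $\mathcal P_n$ is the set of algebraic polynomials of degree at most $n$) is given by $M_n(s)=\dfrac{1}{\sqrt{\lambda_{\min}(C_{n,1})}}=\dfrac{1}{\sqrt{x_1}}$, where $x_1$ is the smallest zero of $\pi_n$. *)

theory Defs
  imports "HOL-Analysis.Analysis" "HOL-Computational_Algebra.Polynomial"
    "Jordan_Normal_Form.Gauss_Jordan_Elimination" "Jordan_Normal_Form.Char_Poly"
begin

definition lag_w :: "real \<Rightarrow> real \<Rightarrow> real" where
  "lag_w s t = t powr s * exp (- t)"

definition lag_ip :: "real \<Rightarrow> real poly \<Rightarrow> real poly \<Rightarrow> real" where
  "lag_ip s p q = (LINT t:{0<..}|lborel. poly p t * poly q t * lag_w s t)"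

definition lag_norm :: "real \<Rightarrow> complex poly \<Rightarrow> real" where
  "lag_norm s p = sqrt (LINT t:{0<..}|lborel. (cmod (poly p (complex_of_real t)))^2 * lag_w s t)"

definition laguerre_orthonormal :: "real \<Rightarrow> (nat \<Rightarrow> real poly) \<Rightarrow> bool" where
  "laguerre_orthonormal s l \<longleftrightarrow>
     (\<forall>k. degree (l k) = k \<and> lead_coeff (l k) > 0) \<and>
     (\<forall>i j. lag_ip s (l i) (l j) = (if i = j then 1 else 0))"

text \<open>The matrix A_{n,1}, 0-based: entry (i,j) is a_{i+1,j+1} = (l_{j+1}', l_i)_w.\<close>
definition A_mat :: "real \<Rightarrow> (nat \<Rightarrow> real poly) \<Rightarrow> nat \<Rightarrow> real mat" where
  "A_mat s l n = mat n n (\<lambda>(i, j). lag_ip s (pderiv (l (j + 1))) (l i))"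

definition C_mat :: "real \<Rightarrow> (nat \<Rightarrow> real poly) \<Rightarrow> nat \<Rightarrow> real mat" where
  "C_mat s l n = the (mat_inverse (transpose_mat (A_mat s l n))) * the (mat_inverse (A_mat s l n))"

definition lag_alpha :: "real \<Rightarrow> nat \<Rightarrow> real" where
  "lag_alpha s \<nu> = (if \<nu> = 0 then 1 + s else 2 + s / (real \<nu> + 1))"

definition lag_beta :: "real \<Rightarrow> nat \<Rightarrow> real" where
  "lag_beta s \<nu> = 1 + s / real \<nu>"

text \<open>Monic polynomials: pi_0 = 1, pi_1 = x - alpha_0 (pi_{-1} = 0),
  pi_{nu+1} = (x - alpha_nu) pi_nu - beta_nu pi_{nu-1}.\<close>
fun lag_pi :: "real \<Rightarrow> nat \<Rightarrow> real poly" where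
  "lag_pi s 0 = 1"
| "lag_pi s (Suc 0) = [:- lag_alpha s 0, 1:]"
| "lag_pi s (Suc (Suc k)) =
     [:- lag_alpha s (Suc k), 1:] * lag_pi s (Suc k) - Polynomial.smult (lag_beta s (Suc k)) (lag_pi s k)"

definition markov_const :: "real \<Rightarrow> nat \<Rightarrow> real" where
  "markov_const s n = Sup {lag_norm s (pderiv p) / lag_norm s p | p. degree p \<le> n \<and> p \<noteq> 0}"

definition lambda_min :: "real mat \<Rightarrow> real" where
  "lambda_min C = Min {k. eigenvalue C k}"

end

theory Submission
  imports Defs
begin

text \<open>Integrating the Pearson equation \<open>(t w)' = (s + 1 - t) w\<close> by parts gives
  \<open>l\<^sub>j = b\<^sub>j l\<^sub>j\<^sub>+\<^sub>1' + l\<^sub>j'\<close> with \<open>b\<^sub>j\<^sup>2 = \<beta>\<^sub>j\<^sub>+\<^sub>1\<close>. Thus the inverse of \<open>A\<close> is the upper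
  bidiagonal matrix \<open>B\<close> with diagonal \<open>b\<close> and superdiagonal \<open>1\<close>, and \<open>C = B\<^sup>T B\<close>. If
  \<open>p' = \<Sum> y\<^sub>i l\<^sub>i\<close>, then \<open>B y\<close> lists the coefficients of \<open>p\<close> up to the constant one, so the extremal
  problem is to minimise \<open>|B y|\<^sup>2 / |y|\<^sup>2\<close>. At the smallest zero \<open>z\<close> of \<open>\<pi>\<^sub>n\<close> the signs
  \<open>(-1)\<^sup>k \<pi>\<^sub>k(z)\<close> are positive for \<open>k < n\<close>, so eliminating variables one by one writes
  \<open>|B y|\<^sup>2 - z |y|\<^sup>2\<close> as a sum of squares that vanishes for an explicit \<open>y \<noteq> 0\<close>.\<close>

section \<open>Moments of the Laguerre weight and the Pearson identity\<close>

definition lag_L :: "real \<Rightarrow> real poly \<Rightarrow> real" where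
  "lag_L s p = (LINT t:{0<..}|lborel. poly p t * lag_w s t)"

lemma lag_ip_eq: "lag_ip s p q = lag_L s (p * q)"
  by (simp add: lag_ip_def lag_L_def)

text \<open>Euler's integral for Gamma; \<open>s > -1\<close> makes the argument positive for every
  \<open>k\<close>.\<close>

lemma has_bochner_integral_moment:
  assumes "s > -1"
  shows "has_bochner_integral lborel (\<lambda>t. indicator {0<..} t *\<^sub>R (t ^ k * lag_w s t))
           (Gamma (real k + s + 1))"
proof (rule has_bochner_integral_nn_integral)
  have "(\<integral>\<^sup>+ t. ennreal (indicator {0<..} t *\<^sub>R (t ^ k * lag_w s t)) \<partial>lborel) =
      (\<integral>\<^sup>+ t. ennreal (indicator {0..} t * t powr (real k + s + 1 - 1) / exp t) \<partial>lborel)"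
  proof (intro nn_integral_cong arg_cong[of _ _ ennreal])
    fix t :: real
    show "indicator {0<..} t *\<^sub>R (t ^ k * lag_w s t) =
        indicator {0..} t * t powr (real k + s + 1 - 1) / exp t"
      \<comment> \<open>The two indicators differ only at 0, where \<open>0 powr a = 0\<close> makes
        both sides vanish.\<close>
      by (cases "t = 0") (auto simp: indicator_def lag_w_def powr_add powr_realpow exp_minus field_simps)
  qed
  also have "\<dots> = ennreal (Gamma (real k + s + 1))"
    using assms by (intro Gamma_conv_nn_integral_real[symmetric]) auto
  finally show "(\<integral>\<^sup>+ t. ennreal (indicator {0<..} t *\<^sub>R (t ^ k * lag_w s t)) \<partial>lborel) =
      ennreal (Gamma (real k + s + 1))" .
qed (use assms in \<open>auto simp: lag_w_def indicator_def intro!: Gamma_real_nonneg AE_I2\<close>)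

lemma has_bochner_integral_poly:
  assumes "s > -1"
  shows "has_bochner_integral lborel (\<lambda>t. indicator {0<..} t *\<^sub>R (poly p t * lag_w s t))
           (\<Sum>k\<le>degree p. coeff p k * Gamma (real k + s + 1))"
proof -
  have "has_bochner_integral lborel
      (\<lambda>t. \<Sum>k\<le>degree p. coeff p k * (indicator {0<..} t *\<^sub>R (t ^ k * lag_w s t)))
      (\<Sum>k\<le>degree p. coeff p k * Gamma (real k + s + 1))"
    using assms
    by (intro has_bochner_integral_sum has_bochner_integral_mult_right has_bochner_integral_moment)
  also have "(\<lambda>t. \<Sum>k\<le>degree p. coeff p k * (indicator {0<..} t *\<^sub>R (t ^ k * lag_w s t))) =
      (\<lambda>t. indicator {0<..} t *\<^sub>R (poly p t * lag_w s t))"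
    by (auto simp: poly_altdef sum_distrib_left sum_distrib_right algebra_simps fun_eq_iff)
  finally show ?thesis .
qed

lemma set_integrable_poly:
  "s > -1 \<Longrightarrow> set_integrable lborel {0<..} (\<lambda>t. poly p t * lag_w s t)"
  using has_bochner_integral_poly[of s p]
  unfolding set_integrable_def by (rule has_bochner_integral_iff[THEN iffD1, THEN conjunct1])

lemma lag_L_monom: "s > -1 \<Longrightarrow> lag_L s (monom 1 k) = Gamma (real k + s + 1)"
  using has_bochner_integral_moment[of s k]
  by (simp add: lag_L_def set_lebesgue_integral_def poly_monom has_bochner_integral_iff)

lemma lag_L_add: "s > -1 \<Longrightarrow> lag_L s (p + q) = lag_L s p + lag_L s q"
  by (simp add: lag_L_def distrib_right set_integral_add(2) set_integrable_poly)

lemma lag_L_smult: "lag_L s (Polynomial.smult c p) = c * lag_L s p"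
  by (simp add: lag_L_def mult.assoc)

lemma lag_L_0: "lag_L s 0 = 0"
  by (simp add: lag_L_def)

lemma lag_L_uminus: "lag_L s (- p) = - lag_L s p"
  using lag_L_smult[of s "-1" p] by simp

lemma lag_L_diff: "s > -1 \<Longrightarrow> lag_L s (p - q) = lag_L s p - lag_L s q"
  using lag_L_add[of s p "-q"] by (simp add: lag_L_uminus)

lemma lag_L_sum: "s > -1 \<Longrightarrow> lag_L s (\<Sum>i\<in>A. f i) = (\<Sum>i\<in>A. lag_L s (f i))"
  by (induction A rule: infinite_finite_induct) (auto simp: lag_L_0 lag_L_add)

text \<open>The integrand is the derivative of \<open>t p(t) w(t)\<close>. On monomials the identity
  is the functional equation of Gamma, and linearity extends it to \<open>p\<close>, so no boundary
  terms need to be estimated.\<close>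

lemma lag_L_pearson:
  assumes "s > -1"
  shows "lag_L s ([:0, 1:] * pderiv p + [:s + 1, -1:] * p) = 0"
proof -
  have monom: "lag_L s ([:0, 1:] * pderiv (monom 1 k) + [:s + 1, -1:] * monom 1 k) = 0" for k
  proof -
    have "[:0, 1:] * pderiv (monom 1 k) + [:s + 1, -1:] * monom 1 k
        = Polynomial.smult (real k + s + 1) (monom 1 k) - monom 1 (Suc k)"
      by (intro poly_eq_poly_eq_iff[THEN iffD1] ext, cases k)
         (auto simp: pderiv_monom poly_monom algebra_simps)
    moreover have "Gamma (real (Suc k) + s + 1) = (real k + s + 1) * Gamma (real k + s + 1)"
      using Gamma_plus1[of "real k + s + 1"] assms by (auto simp: algebra_simps nonpos_Ints_def)
    ultimately show ?thesis
      using assms by (simp add: lag_L_diff lag_L_smult lag_L_monom)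
  qed
  have "[:0, 1:] * pderiv p + [:s + 1, -1:] * p =
     (\<Sum>k\<le>degree p. Polynomial.smult (coeff p k) ([:0, 1:] * pderiv (monom 1 k) + [:s + 1, -1:] * monom 1 k))"
    by (subst (1 2) poly_as_sum_of_monoms[of p, symmetric])
       (simp add: pderiv_sum pderiv_smult sum_distrib_left smult_add_right sum.distrib smult_monom mult.commute
          flip: pderiv_smult mult_smult_right)
  then show ?thesis
    using assms monom by (simp add: lag_L_sum lag_L_smult)
qed


section \<open>Orthonormal expansions and the derivative relation\<close>

locale laguerre =
  fixes s :: real and l :: "nat \<Rightarrow> real poly"
  assumes s: "s > -1" and ortho: "laguerre_orthonormal s l"
begin

abbreviation "L \<equiv> lag_L s"

lemma degree_l: "degree (l k) = k"
  and lead_pos: "coeff (l k) k > 0"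
  and L_l_l: "L (l i * l j) = (if i = j then 1 else 0)"
  using ortho unfolding laguerre_orthonormal_def lag_ip_eq by metis+

lemma coeff_l_eq_0: "k < i \<Longrightarrow> coeff (l k) i = 0"
  by (simp add: coeff_eq_0 degree_l)

lemmas L_linear = lag_L_add[OF s] lag_L_diff[OF s] lag_L_sum[OF s] lag_L_smult lag_L_0

text \<open>Subtracting a multiple of \<open>l m\<close> removes the top coefficient. The hypothesis
  is about coefficients because \<open>degree p < m\<close> could not express \<open>p = 0\<close>
  when \<open>m = 0\<close>.\<close>

lemma expansion:
  assumes "\<And>i. i \<ge> m \<Longrightarrow> coeff p i = 0"
  obtains c where "p = (\<Sum>i<m. Polynomial.smult (c i) (l i))"
  using assms
proof (induction m arbitrary: p thesis)
  case 0
  then have "p = 0" by (intro poly_eqI) simp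
  with 0 show ?case by simp
next
  case (Suc m)
  define a where "a = coeff p m / coeff (l m) m"
  have "coeff (p - Polynomial.smult a (l m)) i = 0" if "i \<ge> m" for i
    using that Suc.prems(2)[of i] lead_pos[of m] coeff_l_eq_0[of m i]
    by (cases "i = m") (auto simp: a_def)
  then obtain c where "p - Polynomial.smult a (l m) = (\<Sum>i<m. Polynomial.smult (c i) (l i))"
    using Suc.IH by blast
  then have "p = (\<Sum>i<Suc m. Polynomial.smult ((c(m := a)) i) (l i))"
    by (simp add: algebra_simps)
  then show ?case by (rule Suc.prems(1))
qed

lemma L_sum_l_mult:
  "L ((\<Sum>i<m. Polynomial.smult (c i) (l i)) * (\<Sum>i<m. Polynomial.smult (d i) (l i))) = (\<Sum>i<m. c i * d i)"
  by (simp add: sum_product L_linear L_l_l if_distrib sum.delta mult.commute cong: if_cong)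

text \<open>Only the \<open>l m\<close> component of \<open>p\<close> survives, and it is read off
  from the coefficient of degree \<open>m\<close>. Integrals thus become comparisons of leading
  coefficients.\<close>

lemma L_l_mult:
  assumes "\<And>i. i > m \<Longrightarrow> coeff p i = 0"
  shows "L (l m * p) = coeff p m / coeff (l m) m"
proof -
  obtain c where c: "p = (\<Sum>i<Suc m. Polynomial.smult (c i) (l i))"
    using expansion[of "Suc m" p] assms by (metis Suc_le_eq)
  have "L (l m * p) = c m"
    unfolding c sum_distrib_left by (simp add: L_linear L_l_l)
  moreover have "coeff p m = c m * coeff (l m) m"
    unfolding c by (simp add: coeff_sum coeff_l_eq_0)
  ultimately show ?thesis using lead_pos[of m] by simp
qed

lemma L_square_eq_0:
  assumes "L (p * p) = 0"
  shows "p = 0"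
proof -
  obtain c where c: "p = (\<Sum>i<Suc (degree p). Polynomial.smult (c i) (l i))"
    using expansion[of "Suc (degree p)" p] by (metis coeff_eq_0 Suc_le_eq)
  have "(\<Sum>i<Suc (degree p). c i * c i) = 0"
    using assms L_sum_l_mult[of c "Suc (degree p)" c] c by metis
  then have "\<forall>i<Suc (degree p). c i = 0"
    by (subst (asm) sum_nonneg_eq_0_iff) auto
  then show ?thesis by (subst c) (auto intro: sum.neutral)
qed

text \<open>Definiteness for the weight \<open>t w(t)\<close>: a nonnegative integrand with integral
  0 vanishes almost everywhere, and the factor \<open>t > 0\<close> can be cancelled.\<close>

lemma L_X_square_eq_0:
  assumes "L ([:0, 1:] * p * p) = 0"
  shows "p = 0"
proof -
  have "(LINT t|lborel. indicator {0<..} t *\<^sub>R (poly ([:0, 1:] * p * p) t * lag_w s t)) = 0"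
    using assms by (simp add: lag_L_def set_lebesgue_integral_def)
  then have "AE t in lborel. indicator {0<..} t *\<^sub>R (poly ([:0, 1:] * p * p) t * lag_w s t) = 0"
    using set_integrable_poly[OF s, of "[:0, 1:] * p * p"]
    by (subst (asm) integral_nonneg_eq_0_iff_AE)
       (auto simp: set_integrable_def indicator_def lag_w_def intro!: AE_I2 mult_nonneg_nonneg)
  then have "AE t in lborel. indicator {0<..} t *\<^sub>R (poly (p * p) t * lag_w s t) = 0"
    by eventually_elim (auto simp: indicator_def)
  then have "L (p * p) = 0"
    unfolding lag_L_def set_lebesgue_integral_def by (rule integral_eq_zero_AE)
  then show ?thesis by (rule L_square_eq_0)
qed

text \<open>Integration by parts: the product rule and the Pearson identity for
  \<open>f * r\<close>.\<close>

lemma L_X_pderiv_mult: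
  "L ([:0, 1:] * pderiv f * r) = - L (f * ([:0, 1:] * pderiv r + [:s + 1, -1:] * r))"
proof -
  have "[:0, 1:] * pderiv (f * r) + [:s + 1, -1:] * (f * r)
      = [:0, 1:] * pderiv f * r + f * ([:0, 1:] * pderiv r + [:s + 1, -1:] * r)"
    by (simp only: pderiv_mult) (simp only: algebra_simps)
  with lag_L_pearson[OF s, of "f * r"] show ?thesis
    by (simp only: lag_L_add[OF s])
qed

text \<open>Both \<open>l\<^sub>j - l\<^sub>j'\<close> and \<open>l\<^sub>j\<^sub>+\<^sub>1'\<close> have degree \<open>j\<close> and are orthogonal to all
  polynomials of degree \<open>< j\<close> for the weight \<open>t w(t)\<close>; hence they are proportional, and pairing
  them with \<open>l\<^sub>j\<^sub>+\<^sub>1'\<close> gives the factor.\<close>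

lemma l_eq_pderiv:
  "l j = Polynomial.smult (sqrt (lag_beta s (Suc j))) (pderiv (l (Suc j))) + pderiv (l j)"
proof -
  define g where "g = pderiv (l (Suc j))"
  define u where "u = l j - pderiv (l j)"
  \<comment> \<open>The quotient of the coefficients of degree \<open>j\<close> in \<open>u\<close>
    and \<open>g\<close>, so that \<open>u - c g\<close> has no term of degree
    \<open>j\<close>.\<close>
  define c where "c = coeff (l j) j / (real (Suc j) * coeff (l (Suc j)) (Suc j))"
  have c_pos: "c > 0"
    using lead_pos by (simp add: c_def)
  have g_high: "coeff g i = 0" if "i > j" for i
    using that by (simp add: g_def coeff_pderiv coeff_l_eq_0)
  have Lg: "L ([:0, 1:] * g * r) = coeff r j / coeff (l (Suc j)) (Suc j)"
    if r: "\<And>i. i > j \<Longrightarrow> coeff r i = 0" for r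
  proof -
    \<comment> \<open>With the derivative moved onto \<open>r\<close>, the second factor has degree
      at most \<open>Suc j\<close>, and its coefficient there is \<open>- coeff r j\<close>.\<close>
    have "L (l (Suc j) * ([:0, 1:] * pderiv r + [:s + 1, -1:] * r)) =
       coeff ([:0, 1:] * pderiv r + [:s + 1, -1:] * r) (Suc j) / coeff (l (Suc j)) (Suc j)"
      by (rule L_l_mult) (auto simp: coeff_pCons coeff_pderiv r split: nat.split)
    then show ?thesis
      unfolding g_def L_X_pderiv_mult by (simp add: coeff_pderiv r)
  qed
  have Lu: "L ([:0, 1:] * u * r) = (real j + s + 1) * coeff r j / coeff (l j) j"
    if r: "\<And>i. i > j \<Longrightarrow> coeff r i = 0" for r
  proof -
    have "L ([:0, 1:] * u * r) = L (l j * ([:0, 1:] * r)) - L ([:0, 1:] * pderiv (l j) * r)"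
      by (simp add: u_def algebra_simps flip: lag_L_diff[OF s])
    \<comment> \<open>The two contributions of \<open>t r\<close> cancel, which leaves a second
      factor of degree at most \<open>j\<close>.\<close>
    also have "\<dots> = L (l j * ([:0, 1:] * pderiv r + Polynomial.smult (s + 1) r))"
    proof -
      have "[:0, 1:] * r + ([:0, 1:] * pderiv r + [:s + 1, -1:] * r)
          = [:0, 1:] * pderiv r + Polynomial.smult (s + 1) r"
        by (intro poly_eq_poly_eq_iff[THEN iffD1] ext) (simp add: algebra_simps)
      from this[symmetric] show ?thesis
        unfolding L_X_pderiv_mult by (simp only: distrib_left lag_L_add[OF s])
    qed
    also have "\<dots> = coeff ([:0, 1:] * pderiv r + Polynomial.smult (s + 1) r) j / coeff (l j) j"
      by (rule L_l_mult) (auto simp: coeff_pCons coeff_pderiv r split: nat.split)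
    also have "coeff ([:0, 1:] * pderiv r + Polynomial.smult (s + 1) r) j = (real j + s + 1) * coeff r j"
      by (cases j) (auto simp: coeff_pderiv algebra_simps)
    finally show ?thesis .
  qed
  define d where "d = u - Polynomial.smult c g"
  have d_high: "coeff d i = 0" if "i \<ge> j" for i
  proof (cases "i = j")
    case True
    have "coeff g j = real (Suc j) * coeff (l (Suc j)) (Suc j)"
      by (simp add: g_def coeff_pderiv)
    then have "c * coeff g j = coeff (l j) j"
      using lead_pos[of "Suc j"] by (simp add: c_def)
    then show ?thesis
      using True by (simp add: d_def u_def coeff_pderiv coeff_l_eq_0)
  next
    case False
    then show ?thesis
      using that by (simp add: d_def u_def g_high coeff_pderiv coeff_l_eq_0)
  qed
  \<comment> \<open>As \<open>d\<close> has no coefficient from degree \<open>j\<close> on,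
    \<open>Lu\<close> and \<open>Lg\<close> give 0 on it, so its square integrates to 0 against
    \<open>t w(t)\<close>.\<close>
  have "[:0, 1:] * d * d = [:0, 1:] * u * d - Polynomial.smult c ([:0, 1:] * g * d)"
    by (intro poly_eq_poly_eq_iff[THEN iffD1] ext) (simp add: d_def algebra_simps)
  then have "L ([:0, 1:] * d * d) = L ([:0, 1:] * u * d - Polynomial.smult c ([:0, 1:] * g * d))"
    by simp
  also have "\<dots> = L ([:0, 1:] * u * d) - c * L ([:0, 1:] * g * d)"
    by (simp only: L_linear)
  also have "\<dots> = 0"
    using d_high by (simp add: Lu Lg del: mult_pCons_left)
  finally have "d = 0" by (rule L_X_square_eq_0)
  then have u_eq: "u = Polynomial.smult c g"
    by (simp add: d_def)
  \<comment> \<open>Pairing with \<open>g\<close> evaluates both sides by \<open>Lu\<close> and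
    \<open>Lg\<close>; the unknown leading coefficients combine into \<open>1 / c\<close>, which
    leaves an equation for the square of \<open>c\<close>.\<close>
  have "L ([:0, 1:] * u * g) = c * L ([:0, 1:] * g * g)"
    unfolding u_eq by (simp flip: lag_L_smult)
  then have "(real j + s + 1) * coeff g j / coeff (l j) j = c * (coeff g j / coeff (l (Suc j)) (Suc j))"
    using g_high by (simp only: Lu Lg)
  moreover have "coeff g j = real (Suc j) * coeff (l (Suc j)) (Suc j)"
    by (simp add: g_def coeff_pderiv)
  ultimately have "(real j + s + 1) * (real (Suc j) * coeff (l (Suc j)) (Suc j)) / coeff (l j) j
      = c * real (Suc j)"
    using lead_pos[of "Suc j"] by simp
  moreover have "real (Suc j) * coeff (l (Suc j)) (Suc j) / coeff (l j) j = 1 / c"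
    by (simp add: c_def)
  ultimately have "(real j + s + 1) * (1 / c) = c * real (Suc j)"
    by (metis times_divide_eq_right)
  then have "c\<^sup>2 = lag_beta s (Suc j)"
    using c_pos by (simp add: lag_beta_def power2_eq_square field_simps)
  then have "c = sqrt (lag_beta s (Suc j))"
    using c_pos by (simp add: real_sqrt_unique)
  with u_eq show ?thesis
    by (simp add: u_def g_def algebra_simps)
qed

end


section \<open>Bidiagonal matrices and the smallest eigenvalue of their Gram matrix\<close>

lemma mat_inverse_eqI:
  fixes A :: "'a :: field mat"
  assumes A: "A \<in> carrier_mat n n" and B: "B \<in> carrier_mat n n" and AB: "A * B = 1\<^sub>m n"
  shows "mat_inverse A = Some B"
proof (cases "mat_inverse A")
  case None
  have "B * A = 1\<^sub>m n"
    using mat_mult_left_right_inverse[OF A B AB] .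
  then have "A \<in> Units (ring_mat TYPE('a) n ())"
    using A B AB by (auto simp: Units_def ring_mat_def)
  with mat_inverse(1)[OF A None, where b = "()"] show ?thesis by blast
next
  case (Some B')
  then have B': "B' \<in> carrier_mat n n" "B' * A = 1\<^sub>m n"
    using mat_inverse(2)[OF A] by auto
  have "B' = (B' * A) * B"
    using A B B'(1) AB by (simp add: assoc_mult_mat[of _ n n _ n _ n])
  with Some B B'(2) show ?thesis by simp
qed

definition bidiag :: "(nat \<Rightarrow> real) \<Rightarrow> nat \<Rightarrow> real mat" where
  "bidiag b n = mat n n (\<lambda>(i, j). if j = i then b i else if j = Suc i then 1 else 0)"

lemma bidiag_carrier [simp]: "bidiag b n \<in> carrier_mat n n"
  and dim_bidiag [simp]: "dim_row (bidiag b n) = n" "dim_col (bidiag b n) = n"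
  by (simp_all add: bidiag_def)

text \<open>The convention \<open>y n = 0\<close> lets the last row, which has no superdiagonal
  entry, follow the general formula.\<close>

lemma sum_bidiag_row:
  fixes b y :: "nat \<Rightarrow> real"
  assumes "i < n" "y n = 0"
  shows "(\<Sum>j = 0..<n. bidiag b n $$ (i, j) * y j) = b i * y i + y (Suc i)"
proof -
  have "(\<Sum>j = 0..<n. bidiag b n $$ (i, j) * y j)
      = (\<Sum>j = 0..<n. (if j = i then b i * y i else 0) + (if j = Suc i then y (Suc i) else 0))"
    using assms(1) by (intro sum.cong) (auto simp: bidiag_def)
  also have "\<dots> = b i * y i + y (Suc i)"
    using assms by (cases "Suc i = n") (auto simp: sum.distrib)
  finally show ?thesis .
qed

lemma sum_bidiag_col:
  fixes b w :: "nat \<Rightarrow> real"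
  assumes "j < n"
  shows "(\<Sum>i = 0..<n. bidiag b n $$ (i, j) * w i) = b j * w j + (if j = 0 then 0 else w (j - 1))"
proof -
  have "(\<Sum>i = 0..<n. bidiag b n $$ (i, j) * w i)
      = (\<Sum>i = 0..<n. (if i = j then b j * w j else 0) + (if i = j - 1 then if j = 0 then 0 else w (j - 1) else 0))"
    using assms by (intro sum.cong) (auto simp: bidiag_def)
  also have "\<dots> = b j * w j + (if j = 0 then 0 else w (j - 1))"
    using assms by (auto simp: sum.distrib)
  finally show ?thesis .
qed

lemma gram_bidiag:
  "transpose_mat (bidiag b n) * bidiag b n = mat n n (\<lambda>(i, j).
     if i = j then (b i)\<^sup>2 + (if i = 0 then 0 else 1)
     else if j = i + 1 then b i else if i = j + 1 then b j else 0)"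
proof (rule eq_matI)
  fix i j
  assume *: "i < dim_row (mat n n (\<lambda>(i, j). if i = j then (b i)\<^sup>2 + (if i = 0 then 0 else 1)
     else if j = i + 1 then b i else if i = j + 1 then b j else 0))"
    "j < dim_col (mat n n (\<lambda>(i, j). if i = j then (b i)\<^sup>2 + (if i = 0 then 0 else 1)
     else if j = i + 1 then b i else if i = j + 1 then b j else 0))"
  then have "(transpose_mat (bidiag b n) * bidiag b n) $$ (i, j)
      = (\<Sum>k = 0..<n. bidiag b n $$ (k, i) * bidiag b n $$ (k, j))"
    by (auto simp: scalar_prod_def intro!: sum.cong)
  also have "\<dots> = b i * bidiag b n $$ (i, j) + (if i = 0 then 0 else bidiag b n $$ (i - 1, j))"
    using * by (subst sum_bidiag_col) auto
  finally show "(transpose_mat (bidiag b n) * bidiag b n) $$ (i, j) = mat n n (\<lambda>(i, j).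
     if i = j then (b i)\<^sup>2 + (if i = 0 then 0 else 1)
     else if j = i + 1 then b i else if i = j + 1 then b j else 0) $$ (i, j)"
    using * by (auto simp: bidiag_def power2_eq_square)
qed auto

text \<open>The \<open>d\<^sub>i\<close> are the pivots of the symmetric elimination of \<open>B\<^sup>T B - z\<close> with
  \<open>B = bidiag b n\<close>. When all but the last are positive and the last one vanishes, \<open>z\<close> is the
  smallest eigenvalue.\<close>

locale critical_pivots =
  fixes n :: nat and b d :: "nat \<Rightarrow> real" and z :: real
  assumes n: "n \<ge> 1"
    and b_pos: "\<And>i. b i > 0"
    and d_0: "d 0 = (b 0)\<^sup>2 - z"
    and d_Suc: "\<And>i. Suc i < n \<Longrightarrow> d (Suc i) = 1 + (b (Suc i))\<^sup>2 - z - (b i)\<^sup>2 / d i"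
    and d_pos: "\<And>i. Suc i < n \<Longrightarrow> d i > 0"
    and d_last: "d (n - 1) = 0"
begin

text \<open>Completing the square in \<open>y 0\<close>, ..., \<open>y (m - 1)\<close> one after the
  other turns the coefficient of the last variable into the pivot \<open>d m\<close>.\<close>

lemma elimination:
  assumes "m < n"
  shows "(\<Sum>i<m. (b i * y i + y (Suc i))\<^sup>2) + ((b m)\<^sup>2 - z) * (y m)\<^sup>2
       = z * (\<Sum>i<m. (y i)\<^sup>2) + d m * (y m)\<^sup>2 + (\<Sum>i<m. (d i * y i + b i * y (Suc i))\<^sup>2 / d i)"
  using assms
proof (induction m)
  case 0
  then show ?case by (simp add: d_0)
next
  case (Suc m)
  have "d m > 0" using Suc.prems by (rule d_pos)
  then have "(d m * y m + b m * y (Suc m))\<^sup>2 / d m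
      = d m * (y m)\<^sup>2 + 2 * b m * y m * y (Suc m) + (b m)\<^sup>2 / d m * (y (Suc m))\<^sup>2"
    by (simp add: power2_eq_square field_simps)
  moreover have "(b m * y m + y (Suc m))\<^sup>2
      = (b m)\<^sup>2 * (y m)\<^sup>2 + 2 * b m * y m * y (Suc m) + (y (Suc m))\<^sup>2"
    by (simp add: power2_eq_square algebra_simps)
  moreover have "((b (Suc m))\<^sup>2 - z) * (y (Suc m))\<^sup>2 + (y (Suc m))\<^sup>2
      = d (Suc m) * (y (Suc m))\<^sup>2 + (b m)\<^sup>2 / d m * (y (Suc m))\<^sup>2"
  proof -
    have "d (Suc m) + (b m)\<^sup>2 / d m = 1 + (b (Suc m))\<^sup>2 - z"
      using d_Suc[OF Suc.prems] by simp
    from arg_cong[OF this, of "\<lambda>c. c * (y (Suc m))\<^sup>2"] show ?thesis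
      by (simp only: algebra_simps)
  qed
  ultimately show ?case
    using Suc.IH Suc.prems by (simp add: algebra_simps)
qed

text \<open>The case \<open>m = n - 1\<close> of the elimination: the last pivot is 0, and
  \<open>y n = 0\<close> reduces the last square on the left to a multiple of the square of
  \<open>y (n - 1)\<close>.\<close>

lemma sum_squares_eq:
  assumes "y n = 0"
  shows "(\<Sum>i<n. (b i * y i + y (Suc i))\<^sup>2)
       = z * (\<Sum>i<n. (y i)\<^sup>2) + (\<Sum>i<n - 1. (d i * y i + b i * y (Suc i))\<^sup>2 / d i)"
proof -
  obtain m where m: "n = Suc m" using n by (cases n) auto
  with elimination[of m y] assms d_last show ?thesis
    by (simp add: algebra_simps power_mult_distrib)
qed

lemma sum_squares_ge:
  assumes "y n = 0"
  shows "z * (\<Sum>i<n. (y i)\<^sup>2) \<le> (\<Sum>i<n. (b i * y i + y (Suc i))\<^sup>2)"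
proof -
  have "0 \<le> (\<Sum>i<n - 1. (d i * y i + b i * y (Suc i))\<^sup>2 / d i)"
    by (intro sum_nonneg divide_nonneg_nonneg less_imp_le[OF d_pos]) auto
  then show ?thesis
    unfolding sum_squares_eq[of y, OF assms] by simp
qed

text \<open>The solution of \<open>d i * v i + b i * v (Suc i) = 0\<close> with
  \<open>v 0 = 1\<close>, at which every completed square vanishes. The factor
  \<open>d (n - 1) = 0\<close> gives \<open>v n = 0\<close>.\<close>

definition v :: "nat \<Rightarrow> real" where
  "v k = (\<Prod>i<k. - (d i / b i))"

lemma v_0: "v 0 = 1"
  by (simp add: v_def)

lemma b_v_Suc: "b i * v (Suc i) = - d i * v i"
  using b_pos[of i] by (simp add: v_def)

lemma v_n: "v n = 0"
  using n d_last by (auto simp: v_def)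

lemma sum_squares_v: "(\<Sum>i<n. (b i * v i + v (Suc i))\<^sup>2) = z * (\<Sum>i<n. (v i)\<^sup>2)"
  by (simp add: sum_squares_eq v_n b_v_Suc)

text \<open>Component \<open>j\<close> of the eigenvector equation, with \<open>B\<close> applied
  first and then its transpose. Expressing the neighbours of \<open>v j\<close> through
  \<open>v j\<close> leaves the pivot recurrence.\<close>

lemma gram_v:
  assumes "j < n"
  shows "b j * (b j * v j + v (Suc j)) + (if j = 0 then 0 else b (j - 1) * v (j - 1) + v j) = z * v j"
proof (cases j)
  case 0
  then show ?thesis
    using b_v_Suc[of 0] by (simp add: d_0 algebra_simps power2_eq_square)
next
  case (Suc k)
  have "d k > 0" using d_pos Suc assms by simp
  then have "b k * v k = - (b k)\<^sup>2 / d k * v (Suc k)"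
    using b_v_Suc[of k] by (simp add: field_simps power2_eq_square)
  then show ?thesis
    using b_v_Suc[of j] d_Suc[of k] Suc assms by (simp add: algebra_simps power2_eq_square)
qed

lemma eigenvalue_gram: "eigenvalue (transpose_mat (bidiag b n) * bidiag b n) z"
proof -
  let ?B = "bidiag b n"
  have "?B *\<^sub>v vec n v = vec n (\<lambda>i. b i * v i + v (Suc i))"
    using v_n by (intro eq_vecI) (auto simp: scalar_prod_def sum_bidiag_row[symmetric])
  moreover have "transpose_mat ?B *\<^sub>v vec n (\<lambda>i. b i * v i + v (Suc i)) = z \<cdot>\<^sub>v vec n v"
    by (intro eq_vecI) (auto simp: scalar_prod_def sum_bidiag_col simp flip: gram_v)
  ultimately have "(transpose_mat ?B * ?B) *\<^sub>v vec n v = z \<cdot>\<^sub>v vec n v"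
    by (subst assoc_mult_mat_vec[of _ n n _ n]) auto
  moreover have "vec n v \<noteq> 0\<^sub>v n"
    using n v_0 by (auto simp: vec_eq_iff intro!: exI[of _ 0])
  ultimately show ?thesis
    unfolding eigenvalue_def eigenvector_def by (intro exI[of _ "vec n v"]) auto
qed

text \<open>Rayleigh quotient: an eigenvector \<open>x\<close> satisfies
  \<open>k |x|^2 = |B x|^2\<close>, which is at least \<open>z |x|^2\<close>.\<close>

lemma eigenvalue_gram_ge:
  assumes "eigenvalue (transpose_mat (bidiag b n) * bidiag b n) k"
  shows "z \<le> k"
proof -
  let ?B = "bidiag b n"
  obtain x where x: "x \<in> carrier_vec n" "x \<noteq> 0\<^sub>v n" "(transpose_mat ?B * ?B) *\<^sub>v x = k \<cdot>\<^sub>v x"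
    using assms by (auto simp: eigenvalue_def eigenvector_def)
  \<comment> \<open>Extension by zero, since \<open>sum_squares_ge\<close> needs
    \<open>y n = 0\<close> and \<open>x\<close> has no entry at \<open>n\<close>.\<close>
  define y where "y i = (if i < n then vec_index x i else 0)" for i
  have y_n: "y n = 0"
    by (simp add: y_def)
  have x_eq: "x = vec n y"
    using x(1) by (auto simp: y_def)
  have Bx: "?B *\<^sub>v x = vec n (\<lambda>i. b i * y i + y (Suc i))"
    unfolding x_eq
    by (intro eq_vecI) (auto simp: scalar_prod_def sum_bidiag_row[of _ n y, OF _ y_n])
  have "k * (\<Sum>i<n. (y i)\<^sup>2) = ((transpose_mat ?B * ?B) *\<^sub>v x) \<bullet> x"
    unfolding x(3) unfolding x_eq
    by (simp add: scalar_prod_def sum_distrib_left power2_eq_square lessThan_atLeast0 mult.assoc)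
  also have "\<dots> = (transpose_mat ?B *\<^sub>v (?B *\<^sub>v x)) \<bullet> x"
    using x(1) by (subst assoc_mult_mat_vec[of _ n n _ n]) auto
  also have "\<dots> = (?B *\<^sub>v x) \<bullet> (?B *\<^sub>v x)"
    using x(1) by (intro transpose_vec_mult_scalar[of _ n n] mult_mat_vec_carrier[of _ n n]) auto
  also have "\<dots> = (\<Sum>i<n. (b i * y i + y (Suc i))\<^sup>2)"
    unfolding Bx by (simp add: scalar_prod_def power2_eq_square lessThan_atLeast0)
  finally have "z * (\<Sum>i<n. (y i)\<^sup>2) \<le> k * (\<Sum>i<n. (y i)\<^sup>2)"
    using sum_squares_ge[of y, OF y_n] by simp
  moreover have "(\<Sum>i<n. (y i)\<^sup>2) > 0"
  proof -
    obtain i where "i < n" "y i \<noteq> 0"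
      using x(2) unfolding x_eq by (auto simp: vec_eq_iff)
    then show ?thesis by (intro sum_pos2[of _ i]) auto
  qed
  ultimately show ?thesis by simp
qed

lemma lambda_min_gram: "lambda_min (transpose_mat (bidiag b n) * bidiag b n) = z"
proof -
  let ?C = "transpose_mat (bidiag b n) * bidiag b n"
  have C: "?C \<in> carrier_mat n n" by auto
  have "finite {k. eigenvalue ?C k}"
    unfolding eigenvalue_root_char_poly[OF C]
    using degree_monic_char_poly[OF C] by (intro poly_roots_finite) auto
  then show ?thesis
    unfolding lambda_min_def
    using eigenvalue_gram eigenvalue_gram_ge by (intro Min_eqI) auto
qed

end

section \<open>Signs of the polynomials and their smallest zeros\<close>

lemma lag_pi_eval_Suc:
  "poly (lag_pi s (Suc (Suc k))) x
     = (x - lag_alpha s (Suc k)) * poly (lag_pi s (Suc k)) x - lag_beta s (Suc k) * poly (lag_pi s k) x"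
  by (simp add: algebra_simps)

lemma lag_beta_pos: "s > -1 \<Longrightarrow> lag_beta s (Suc k) > 0"
  by (simp add: lag_beta_def field_simps add_pos_nonneg)

text \<open>This matches the recurrence with the Gram matrix, whose diagonal entries after the first
  are \<open>1 + (b i)^2\<close>.\<close>

lemma lag_alpha_Suc: "lag_alpha s (Suc k) = 1 + lag_beta s (Suc (Suc k))"
  by (simp add: lag_alpha_def lag_beta_def)

text \<open>The sign makes the values positive to the left of all zeros; ratios of consecutive
  values will be the pivots.\<close>

definition signed_pi :: "real \<Rightarrow> real \<Rightarrow> nat \<Rightarrow> real" where
  "signed_pi s x k = (-1) ^ k * poly (lag_pi s k) x"

lemma signed_pi_0 [simp]: "signed_pi s x 0 = 1"
  and signed_pi_1: "signed_pi s x (Suc 0) = lag_beta s (Suc 0) - x"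
  by (simp_all add: signed_pi_def lag_alpha_def lag_beta_def)

lemma signed_pi_Suc:
  "signed_pi s x (Suc (Suc k))
     = (1 + lag_beta s (Suc (Suc k)) - x) * signed_pi s x (Suc k) - lag_beta s (Suc k) * signed_pi s x k"
  by (simp add: signed_pi_def lag_pi_eval_Suc lag_alpha_Suc algebra_simps del: lag_pi.simps)

text \<open>Positivity alone does not survive the subtraction in the recurrence; the growth bound
  absorbs the subtracted term and carries the induction.\<close>

lemma signed_pi_pos_aux:
  assumes "s > -1" "x \<le> 0"
  shows "signed_pi s x k > 0 \<and> signed_pi s x (Suc k) \<ge> lag_beta s (Suc k) * signed_pi s x k"
proof (induction k)
  case 0
  then show ?case using assms by (simp add: signed_pi_1)
next
  case (Suc k)
  then have pos: "signed_pi s x (Suc k) > 0"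
    using lag_beta_pos[OF assms(1), of k] by (meson less_le_trans mult_pos_pos)
  moreover have "x * signed_pi s x (Suc k) \<le> 0"
    using pos assms(2) by (simp add: mult_nonpos_nonneg)
  ultimately show ?case using Suc by (simp add: signed_pi_Suc algebra_simps)
qed

lemma signed_pi_pos: "s > -1 \<Longrightarrow> x \<le> 0 \<Longrightarrow> signed_pi s x k > 0"
  using signed_pi_pos_aux by blast

text \<open>Interlacing: at the smallest zero of one polynomial the recurrence makes the next signed
  value negative, while at 0 it is positive. The next smallest zero therefore lies strictly to the
  left, where all earlier signed values are positive.\<close>

lemma lag_pi_smallest_zero:
  assumes "s > -1"
  shows "\<exists>z. signed_pi s z (Suc k) = 0 \<and> (\<forall>j\<le>Suc k. \<forall>x<z. signed_pi s x j > 0) \<and>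
             (\<forall>j\<le>k. signed_pi s z j > 0)"
proof (induction k)
  case 0
  show ?case
    by (intro exI[of _ "lag_beta s (Suc 0)"]) (auto simp: signed_pi_1 le_Suc_eq)
next
  case (Suc k)
  then obtain z where z: "signed_pi s z (Suc k) = 0"
    "\<And>j x. j \<le> Suc k \<Longrightarrow> x < z \<Longrightarrow> signed_pi s x j > 0" "signed_pi s z k > 0"
    by blast
  have poly_eq: "signed_pi s x j = poly (Polynomial.smult ((-1) ^ j) (lag_pi s j)) x" for x j
    by (simp add: signed_pi_def)
  let ?q = "Polynomial.smult ((-1) ^ Suc (Suc k)) (lag_pi s (Suc (Suc k)))"
  have "z > 0"
    using signed_pi_pos[OF assms, of z "Suc k"] z(1) by (cases "z \<le> 0") auto
  moreover have "signed_pi s z (Suc (Suc k)) < 0"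
    using z(1,3) lag_beta_pos[OF assms, of k] by (simp add: signed_pi_Suc)
  moreover have q_0: "signed_pi s 0 (Suc (Suc k)) > 0"
    using assms by (intro signed_pi_pos) auto
  ultimately obtain z0 where z0: "z0 < z" "signed_pi s z0 (Suc (Suc k)) = 0"
    using poly_IVT_neg[of 0 z ?q] unfolding poly_eq by blast
  define Z where "Z = {x. signed_pi s x (Suc (Suc k)) = 0}"
  have "?q \<noteq> 0"
    using q_0 unfolding poly_eq by (metis poly_0 less_irrefl)
  then have fin: "finite Z"
    unfolding Z_def poly_eq by (rule poly_roots_finite)
  define z' where "z' = Min Z"
  have z': "signed_pi s z' (Suc (Suc k)) = 0" "z' < z"
  proof -
    have "z0 \<in> Z" using z0 by (simp add: Z_def)
    then have "z' \<in> Z" "z' \<le> z0"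
      using fin by (auto simp: z'_def intro: Min_in)
    then show "signed_pi s z' (Suc (Suc k)) = 0" "z' < z"
      using z0 by (auto simp: Z_def)
  qed
  \<comment> \<open>A violation would be a negative value at some \<open>x > 0\<close>, and the
    intermediate value theorem on the interval from 0 to \<open>x\<close> would give a zero below
    the minimal one.\<close>
  have "signed_pi s x (Suc (Suc k)) > 0" if "x < z'" for x
  proof (rule ccontr)
    assume neg: "\<not> signed_pi s x (Suc (Suc k)) > 0"
    have no_zero: "signed_pi s t (Suc (Suc k)) \<noteq> 0" if "t < z'" for t
      using that Min_le[OF fin, of t] by (auto simp: z'_def Z_def)
    have "0 < x"
      using neg signed_pi_pos[OF assms, of x "Suc (Suc k)"] by (cases "x \<le> 0") auto
    moreover have "signed_pi s x (Suc (Suc k)) < 0"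
      using neg no_zero[OF that] by simp
    ultimately obtain t where "t < x" "signed_pi s t (Suc (Suc k)) = 0"
      using q_0 poly_IVT_neg[of 0 x ?q] unfolding poly_eq by blast
    with no_zero that show False by auto
  qed
  with z z' show ?case
    by (intro exI[of _ z']) (auto simp: le_Suc_eq)
qed

section \<open>Inversion of \<open>A_mat\<close> and integration in orthonormal coordinates\<close>

context laguerre
begin

definition b :: "nat \<Rightarrow> real" where
  "b i = sqrt (lag_beta s (Suc i))"

lemma b_pos: "b i > 0" and b_square: "(b i)\<^sup>2 = lag_beta s (Suc i)"
  using lag_beta_pos[OF s, of i] by (simp_all add: b_def)

lemma pderiv_l_0: "pderiv (l 0) = 0"
  by (simp add: pderiv_eq_0_iff degree_l)

lemma A_mat_mult_bidiag: "A_mat s l n * bidiag b n = 1\<^sub>m n"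
proof (rule eq_matI)
  fix i j assume "i < dim_row (1\<^sub>m n :: real mat)" "j < dim_col (1\<^sub>m n :: real mat)"
  then have ij: "i < n" "j < n" by auto
  define a where "a k = L (pderiv (l (Suc k)) * l i)" for k
  have "(A_mat s l n * bidiag b n) $$ (i, j) = (\<Sum>k = 0..<n. bidiag b n $$ (k, j) * a k)"
    using ij by (auto simp: A_mat_def scalar_prod_def lag_ip_eq a_def intro!: sum.cong)
  also have "\<dots> = b j * a j + (if j = 0 then 0 else a (j - 1))"
    using ij by (intro sum_bidiag_col)
  \<comment> \<open>For \<open>j = 0\<close> the missing term agrees with
    \<open>pderiv (l 0) = 0\<close>.\<close>
  also have "\<dots> = L (Polynomial.smult (b j) (pderiv (l (Suc j))) * l i + pderiv (l j) * l i)"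
    by (simp add: L_linear a_def pderiv_l_0)
  also have "\<dots> = L (l j * l i)"
    by (subst (3) l_eq_pderiv) (simp add: b_def distrib_right)
  finally show "(A_mat s l n * bidiag b n) $$ (i, j) = 1\<^sub>m n $$ (i, j)"
    using ij by (simp add: L_l_l)
qed (simp_all add: A_mat_def)

lemma C_mat_eq: "C_mat s l n = transpose_mat (bidiag b n) * bidiag b n"
proof -
  have A: "A_mat s l n \<in> carrier_mat n n" by (simp add: A_mat_def)
  have "bidiag b n * A_mat s l n = 1\<^sub>m n"
    using mat_mult_left_right_inverse[OF A bidiag_carrier A_mat_mult_bidiag] .
  then have "transpose_mat (A_mat s l n) * transpose_mat (bidiag b n) = 1\<^sub>m n"
    using transpose_mult[OF bidiag_carrier A, symmetric] by simp
  then show ?thesis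
    using mat_inverse_eqI[OF A bidiag_carrier A_mat_mult_bidiag]
      mat_inverse_eqI[of "transpose_mat (A_mat s l n)" n "transpose_mat (bidiag b n)"] A
    by (simp add: C_mat_def)
qed

text \<open>The antiderivative in orthonormal coordinates: \<open>y\<close> lists the coordinates of
  the derivative when \<open>y n = 0\<close>, and \<open>c\<close>, the component along
  \<open>l 0\<close>, is the constant of integration.\<close>

definition lift :: "nat \<Rightarrow> real \<Rightarrow> (nat \<Rightarrow> real) \<Rightarrow> real poly" where
  "lift n c y = (\<Sum>i<Suc n. Polynomial.smult (case i of 0 \<Rightarrow> c | Suc k \<Rightarrow> b k * y k + y (Suc k)) (l i))"

text \<open>Each \<open>l i\<close> is expanded by \<open>l_eq_pderiv\<close> and the second terms
  are shifted by one index; \<open>pderiv (l 0) = 0\<close> and \<open>y n = 0\<close> settle the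
  two ends.\<close>

lemma pderiv_lift:
  assumes "y n = 0"
  shows "pderiv (lift n c y) = (\<Sum>i<n. Polynomial.smult (y i) (l i))"
proof -
  have "(\<Sum>i<n. Polynomial.smult (y i) (pderiv (l i))) = (\<Sum>i<Suc n. Polynomial.smult (y i) (pderiv (l i)))"
    by (simp add: assms)
  also have "\<dots> = (\<Sum>i<n. Polynomial.smult (y (Suc i)) (pderiv (l (Suc i))))"
    by (subst sum.lessThan_Suc_shift) (simp add: pderiv_l_0)
  finally have shift: "(\<Sum>i<n. Polynomial.smult (y i) (pderiv (l i)))
      = (\<Sum>i<n. Polynomial.smult (y (Suc i)) (pderiv (l (Suc i))))" .
  have "(\<Sum>i<n. Polynomial.smult (y i) (l i))
      = (\<Sum>i<n. Polynomial.smult (y i) (Polynomial.smult (b i) (pderiv (l (Suc i))) + pderiv (l i)))"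
    using l_eq_pderiv by (simp add: b_def)
  also have "\<dots> = (\<Sum>i<n. Polynomial.smult (b i * y i + y (Suc i)) (pderiv (l (Suc i))))"
    by (simp add: smult_add_right smult_add_left sum.distrib shift mult.commute)
  also have "\<dots> = pderiv (lift n c y)"
    unfolding lift_def
    by (subst sum.lessThan_Suc_shift) (simp add: pderiv_add pderiv_smult pderiv_sum pderiv_l_0)
  finally show ?thesis ..
qed

lemma L_lift_square: "L (lift n c y * lift n c y) = c\<^sup>2 + (\<Sum>i<n. (b i * y i + y (Suc i))\<^sup>2)"
  unfolding lift_def L_sum_l_mult by (subst sum.lessThan_Suc_shift) (simp add: power2_eq_square)

text \<open>With \<open>y\<close> read off from \<open>pderiv p\<close>, the difference to
  \<open>lift n 0 y\<close> has derivative 0, so it is a multiple of \<open>l 0\<close>.\<close>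

lemma eq_lift:
  assumes "degree p \<le> n"
  obtains c y where "y n = 0" "p = lift n c y"
proof -
  have "coeff (pderiv p) i = 0" if "i \<ge> n" for i
    using that assms by (simp add: coeff_pderiv coeff_eq_0)
  then obtain y where y: "pderiv p = (\<Sum>i<n. Polynomial.smult (y i) (l i))"
    using expansion by blast
  \<comment> \<open>The expansion leaves the value at \<open>n\<close> arbitrary; it is reset to
    0.\<close>
  define y' where "y' = y(n := 0)"
  have y'_n: "y' n = 0" by (simp add: y'_def)
  have "pderiv p = pderiv (lift n 0 y')"
    unfolding pderiv_lift[of y', OF y'_n] y by (intro sum.cong) (auto simp: y'_def)
  then have "degree (p - lift n 0 y') = 0"
    by (simp add: pderiv_diff flip: pderiv_eq_0_iff)
  then have "coeff (p - lift n 0 y') i = 0" if "i \<ge> 1" for i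
    using that by (intro coeff_eq_0) simp
  then obtain c where c: "p - lift n 0 y' = (\<Sum>i<1. Polynomial.smult (c i) (l i))"
    using expansion by blast
  have "lift n (c 0) y' = Polynomial.smult (c 0) (l 0) + lift n 0 y'"
    unfolding lift_def by (simp add: sum.lessThan_Suc_shift del: sum.lessThan_Suc)
  with c have "p = lift n (c 0) y'"
    by (simp add: algebra_simps)
  with y'_n show ?thesis by (rule that)
qed

text \<open>Dividing the three-term recurrence by the middle value turns it into the pivot
  recurrence.\<close>

lemma critical_pivots_signed_pi:
  assumes n: "n \<ge> 1" and z: "signed_pi s z n = 0" and pos: "\<And>k. k < n \<Longrightarrow> signed_pi s z k > 0"
  shows "critical_pivots n b (\<lambda>i. signed_pi s z (Suc i) / signed_pi s z i) z"
proof
  show "b i > 0" for i by (rule b_pos)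
  show "signed_pi s z (Suc 0) / signed_pi s z 0 = (b 0)\<^sup>2 - z"
    by (simp add: signed_pi_1 b_square)
  show "signed_pi s z (Suc (Suc i)) / signed_pi s z (Suc i)
      = 1 + (b (Suc i))\<^sup>2 - z - (b i)\<^sup>2 / (signed_pi s z (Suc i) / signed_pi s z i)"
    if "Suc i < n" for i
    using pos[OF that] pos[of i] that by (simp add: b_square signed_pi_Suc field_simps)
  show "signed_pi s z (Suc i) / signed_pi s z i > 0" if "Suc i < n" for i
    using pos[OF that] pos[of i] that by simp
  show "signed_pi s z (Suc (n - 1)) / signed_pi s z (n - 1) = 0"
    using n z by simp
qed (rule n)

end

section \<open>Reduction to real polynomials and the Markov constant\<close>

lemma poly_of_real_eq_Complex:
  "poly p (complex_of_real t) = Complex (poly (map_poly Re p) t) (poly (map_poly Im p) t)"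
  by (induction p) (auto simp: map_poly_pCons complex_eq_iff)

lemma map_poly_Re_pderiv: "map_poly Re (pderiv p) = pderiv (map_poly Re p)"
  and map_poly_Im_pderiv: "map_poly Im (pderiv p) = pderiv (map_poly Im p)"
  by (intro poly_eqI; simp add: coeff_map_poly coeff_pderiv)+

text \<open>On the real axis the squared modulus is the sum of the squares of two real polynomials,
  so the complex problem splits into two real ones.\<close>

lemma lag_norm_eq:
  assumes "s > -1"
  shows "lag_norm s p = sqrt (lag_L s (map_poly Re p * map_poly Re p) + lag_L s (map_poly Im p * map_poly Im p))"
proof -
  have "(cmod (poly p (complex_of_real t)))\<^sup>2
      = poly (map_poly Re p * map_poly Re p + map_poly Im p * map_poly Im p) t" for t
    by (simp add: poly_of_real_eq_Complex cmod_def flip: power2_eq_square)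
  then have "lag_norm s p = sqrt (lag_L s (map_poly Re p * map_poly Re p + map_poly Im p * map_poly Im p))"
    by (simp only: lag_norm_def lag_L_def)
  then show ?thesis by (simp only: lag_L_add[OF assms])
qed

text \<open>The bound is \<open>sum_squares_ge\<close> in orthonormal coordinates, applied to the
  real and imaginary parts; it is attained, so the supremum is a maximum.\<close>

lemma (in laguerre) markov_const_eq:
  assumes z: "z > 0" and piv: "critical_pivots n b d z"
  shows "markov_const s n = 1 / sqrt z"
proof -
  interpret critical_pivots n b d z by (rule piv)
  have L_pderiv_le: "z * L (pderiv p * pderiv p) \<le> L (p * p)" if deg: "degree p \<le> n" for p
  proof -
    obtain c y where y: "y n = 0" and p: "p = lift n c y"
      using eq_lift[OF deg] by blast
    have "L (pderiv p * pderiv p) = (\<Sum>i<n. (y i)\<^sup>2)"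
      unfolding p pderiv_lift[of y, OF y] L_sum_l_mult by (simp add: power2_eq_square)
    moreover have "L (p * p) = c\<^sup>2 + (\<Sum>i<n. (b i * y i + y (Suc i))\<^sup>2)"
      unfolding p by (rule L_lift_square)
    ultimately show ?thesis
      using sum_squares_ge[of y, OF y] by (simp add: add_increasing)
  qed
  \<comment> \<open>The extremal polynomial: \<open>v\<close> gives equality for the derivative
    coordinates, and a nonzero constant component would only enlarge the denominator.\<close>
  define p where "p = lift n 0 v"
  have L_p: "L (p * p) = z * L (pderiv p * pderiv p)"
    unfolding p_def L_lift_square pderiv_lift[of v, OF v_n] L_sum_l_mult
    by (simp add: sum_squares_v) (simp add: power2_eq_square)
  have "L (pderiv p * pderiv p) = (\<Sum>i<n. (v i)\<^sup>2)"
    unfolding p_def pderiv_lift[of v, OF v_n] L_sum_l_mult by (simp add: power2_eq_square)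
  then have L_p_pos: "L (pderiv p * pderiv p) > 0"
    using n v_0 by (auto intro!: sum_pos2[of _ 0])
  define q where "q = map_poly complex_of_real p"
  have Re_q: "map_poly Re q = p" and Im_q: "map_poly Im q = 0"
    by (auto simp: q_def coeff_map_poly intro!: poly_eqI)
  have "lag_norm s (pderiv q) / lag_norm s q = 1 / sqrt z"
    using z L_p_pos
    by (simp add: lag_norm_eq[OF s] map_poly_Re_pderiv map_poly_Im_pderiv Re_q Im_q lag_L_0 L_p real_sqrt_mult)
  moreover have "degree q \<le> n"
  proof -
    have "degree p \<le> n"
      unfolding p_def lift_def
      by (intro degree_sum_le order.trans[OF degree_smult_le]) (auto simp: degree_l)
    then show ?thesis
      unfolding q_def using degree_map_poly_le order.trans by blast
  qed
  moreover have "q \<noteq> 0"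
    using L_p_pos Re_q by (auto simp: lag_L_0)
  ultimately have attained:
    "1 / sqrt z \<in> {lag_norm s (pderiv p) / lag_norm s p | p. degree p \<le> n \<and> p \<noteq> 0}"
    by (intro CollectI exI[of _ q]) auto
  have bound: "lag_norm s (pderiv r) / lag_norm s r \<le> 1 / sqrt z" if "degree r \<le> n" for r
  proof -
    define x where "x = map_poly Re r"
    define y where "y = map_poly Im r"
    have "degree x \<le> n" "degree y \<le> n"
      unfolding x_def y_def using that degree_map_poly_le order.trans by blast+
    then have "z * (L (pderiv x * pderiv x) + L (pderiv y * pderiv y)) \<le> L (x * x) + L (y * y)"
      using L_pderiv_le[of x] L_pderiv_le[of y] by (simp add: distrib_left)
    then have "sqrt z * lag_norm s (pderiv r) \<le> lag_norm s r"
      unfolding lag_norm_eq[OF s] map_poly_Re_pderiv map_poly_Im_pderiv x_def[symmetric] y_def[symmetric]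
      by (simp flip: real_sqrt_mult)
    moreover have "lag_norm s r \<ge> 0"
      by (auto simp: lag_norm_def set_lebesgue_integral_def lag_w_def intro!: Bochner_Integration.integral_nonneg)
    \<comment> \<open>If the norm is 0, the quotient is 0 because division by 0 yields 0.\<close>
    ultimately show ?thesis
      using z by (cases "lag_norm s r = 0") (auto simp: field_simps)
  qed
  show ?thesis
    unfolding markov_const_def using attained bound by (intro cSup_eq_maximum) auto
qed

theorem theorem6p1:
  fixes s :: real and n :: nat and l :: "nat \<Rightarrow> real poly"
  assumes "s > -1" and "n \<ge> 1" and "laguerre_orthonormal s l"
  shows "C_mat s l n = mat n n (\<lambda>(i, j).
            if i = j then lag_alpha s i
            else if j = i + 1 then sqrt (lag_beta s j)
            else if i = j + 1 then sqrt (lag_beta s i)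
            else 0) \<and>
         markov_const s n = 1 / sqrt (lambda_min (C_mat s l n)) \<and>
         markov_const s n = 1 / sqrt (Min {x. poly (lag_pi s n) x = 0})"
proof -
  interpret laguerre s l
    using assms(1,3) by unfold_locales
  obtain k where k: "n = Suc k"
    using assms(2) by (cases n) auto
  obtain z where z: "signed_pi s z n = 0" "\<And>x. x < z \<Longrightarrow> signed_pi s x n > 0"
    "\<And>j. j < n \<Longrightarrow> signed_pi s z j > 0"
    using lag_pi_smallest_zero[OF s, of k] unfolding k by (auto simp: less_Suc_eq_le)
  have z_pos: "z > 0"
    using z(1) signed_pi_pos[OF s, of z n] by (cases "z \<le> 0") auto
  have piv: "critical_pivots n b (\<lambda>i. signed_pi s z (Suc i) / signed_pi s z i) z"
    using assms(2) z(1,3) by (rule critical_pivots_signed_pi)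
  have zeros: "{x. poly (lag_pi s n) x = 0} = {x. signed_pi s x n = 0}"
    by (simp add: signed_pi_def)
  have "lag_pi s n \<noteq> 0"
    using signed_pi_pos[OF s, of 0 n] by (auto simp: signed_pi_def)
  then have "finite {x. signed_pi s x n = 0}"
    unfolding zeros[symmetric] by (rule poly_roots_finite)
  then have "Min {x. poly (lag_pi s n) x = 0} = z"
    unfolding zeros using z by (intro Min_eqI) (force simp: not_less[symmetric])+
  moreover have "lambda_min (C_mat s l n) = z"
    unfolding C_mat_eq by (rule critical_pivots.lambda_min_gram[OF piv])
  moreover have "C_mat s l n = mat n n (\<lambda>(i, j).
            if i = j then lag_alpha s i
            else if j = i + 1 then sqrt (lag_beta s j)
            else if i = j + 1 then sqrt (lag_beta s i)
            else 0)"
  proof -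
    \<comment> \<open>The first column of \<open>B\<close> has no superdiagonal entry, which
      accounts for the separate value of \<open>lag_alpha s 0\<close>.\<close>
    have "(b i)\<^sup>2 + (if i = 0 then 0 else 1) = lag_alpha s i" for i
      by (cases i) (simp_all add: b_square lag_alpha_def lag_beta_def)
    then show ?thesis
      unfolding C_mat_eq gram_bidiag by (intro eq_matI) (auto simp: b_def)
  qed
  ultimately show ?thesis
    using markov_const_eq[OF z_pos piv] by simp
qed

end
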